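(* For each integer $n\ge 3$ there is a nonzero subtree root $\xi_n\in\mathbb{C}$ of the star $K_{1,n-1}$, namely $$\xi_n=a_n\cos\left(\frac{\pi}{n-1}\right)-1+\mathrm{i}\,a_n\sin\left(\frac{\pi}{n-1}\right),$$ and these roots satisfy $$\lim_{n\to\infty}\frac{|\xi_n|}{a_n-1}=1.$$ That is, the lower bound $\sqrt[n-1]{n-1}-1$ on the moduli of nonzero subtree roots of trees of order $n$ is asymptotically sharp as $n\to\infty$.
   Context: For an integer $n\ge 2$, $a_n=(n-1)^{1/(n-1)}$ (so $a_n>1$ for $n\ge 3$). The order of a tree is its number of vertices. A subtree of a tree $T$ is a nonempty connected subgraph of $T$ (equivalently, a nonempty vertex set inducing a connected subgraph). For a tree $T$ of order $n$, let $s_k(T)$ denote the number of subtrees of $T$ with exactly $k$ vertices. The subtree polynomial of $T$ is $\Phi_T(z)=\sum_{k=1}^{n}s_k(T)z^k$. The subtree roots of $T$ are the zeros in $\mathbb{C}$ of $\Phi_T(z)$. $K_{1,n-1}$ denotes the star of order $n$. *)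

theory Defs
  imports Complex_Main "HOL-Computational_Algebra.Polynomial" "Graph_Theory.Graph_Theory"
begin

text \<open>
  Finite simple graphs are rendered by the locale \<^locale>\<open>graph\<close>: finite, loop-free, symmetric
  digraphs without parallel arcs, where an undirected edge is a pair of opposite arcs.
  The library predicate \<^const>\<open>tree\<close> is not usable for these, because traversing an edge back and
  forth is a \<^term>\<open>pre_digraph.cycle\<close> of length 2. Hence only cycles of length at least 3 are
  excluded below. The short name \<open>connected\<close> also belongs to topology, so it is qualified.
\<close>

definition tree_graph :: "('a, 'b) pre_digraph \<Rightarrow> bool" where
  "tree_graph T \<longleftrightarrow> graph T \<and> Digraph_Component.connected T \<and>
     \<not> (\<exists>p. pre_digraph.cycle T p \<and> 3 \<le> length p)"

text \<open>
  The condition \<^term>\<open>graph H\<close> says that \<open>H\<close> contains both or none of the two arcs of each edge.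
  Nonemptiness of \<open>H\<close> is part of the library's notion of connectedness.
\<close>

definition is_subtree :: "('a, 'b) pre_digraph \<Rightarrow> ('a, 'b) pre_digraph \<Rightarrow> bool" where
  "is_subtree H T \<longleftrightarrow> subgraph H T \<and> graph H \<and> Digraph_Component.connected H"

definition num_subtrees :: "('a, 'b) pre_digraph \<Rightarrow> nat \<Rightarrow> nat" where
  "num_subtrees T k = card {H. is_subtree H T \<and> card (verts H) = k}"

definition subtree_poly :: "('a, 'b) pre_digraph \<Rightarrow> complex poly" where
  "subtree_poly T = (\<Sum>k = 1..card (verts T). monom (of_nat (num_subtrees T k)) k)"

definition subtree_root :: "('a, 'b) pre_digraph \<Rightarrow> complex \<Rightarrow> bool" where
  "subtree_root T z \<longleftrightarrow> poly (subtree_poly T) z = 0"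

definition star_graph :: "nat \<Rightarrow> nat pair_pre_digraph" where
  "star_graph n = \<lparr> pverts = {0..<n}, parcs = {0} \<times> {1..<n} \<union> {1..<n} \<times> {0} \<rparr>"

lemma star_graph_complete_bipartite:
  assumes "n \<ge> 1"
  shows "complete_bipartite_digraph 1 (n - 1) (with_proj (star_graph n))"
  unfolding complete_bipartite_digraph_pair_def
proof (intro conjI exI)
  show "pverts (star_graph n) = {0} \<union> {1..<n}"
    using assms by (auto simp: star_graph_def)
qed (auto simp: star_graph_def)

definition a_seq :: "nat \<Rightarrow> real" where
  "a_seq n = (real n - 1) powr (1 / (real n - 1))"

definition xi :: "nat \<Rightarrow> complex" where
  "xi n = complex_of_real (a_seq n * cos (pi / (real n - 1)) - 1)
        + \<i> * complex_of_real (a_seq n * sin (pi / (real n - 1)))"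

end

theory Submission
  imports Defs "HOL-Real_Asymp.Real_Asymp"
begin

text \<open>
  Every subtree of the star with \<open>m = n - 1\<close> leaves is either a single leaf or the centre together
  with an arbitrary set of leaves, because the centre lies on every edge. Hence
  \<open>\<Phi>(z) = m z + z (1 + z) ^ m\<close>, and a nonzero \<open>z\<close> is a root iff \<open>(1 + z) ^ m = - m\<close>
  (lemma \<open>poly_star\<close>). By construction \<open>1 + \<xi>\<^sub>n = a\<^sub>n cis (\<pi> / m)\<close> is an \<open>m\<close>-th root of \<open>- m\<close>
  (lemma \<open>xi_power\<close>).

  For the limit, \<open>|\<xi>\<^sub>n|\<close> is the distance between \<open>1\<close> and \<open>a\<^sub>n cis (\<pi> / m)\<close>. The radial part of that
  distance, \<open>a\<^sub>n - 1\<close>, is of order \<open>ln m / m\<close>, whereas the angular part is only of order \<open>1 / m\<close>,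
  so the ratio tends to \<open>1\<close>.
\<close>

section \<open>Stars as trees\<close>

text \<open>
  The set of leaves is a parameter because the subtrees containing the centre of a star are again
  stars on fewer leaves.
\<close>

definition star_on :: "nat set \<Rightarrow> (nat, nat \<times> nat) pre_digraph" where
  "star_on S = with_proj \<lparr> pverts = insert 0 S, parcs = {0} \<times> S \<union> S \<times> {0} \<rparr>"

definition vertex_graph :: "nat \<Rightarrow> (nat, nat \<times> nat) pre_digraph" where
  "vertex_graph v = with_proj \<lparr> pverts = {v}, parcs = {} \<rparr>"

lemma star_on_simps [simp]:
  "verts (star_on S) = insert 0 S" "arcs (star_on S) = {0} \<times> S \<union> S \<times> {0}"
  "arcs_ends (star_on S) = {0} \<times> S \<union> S \<times> {0}" "tail (star_on S) = fst" "head (star_on S) = snd"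
  by (simp_all add: star_on_def)

lemma vertex_graph_simps [simp]:
  "verts (vertex_graph v) = {v}" "arcs (vertex_graph v) = {}"
  "arcs_ends (vertex_graph v) = {}" "tail (vertex_graph v) = fst" "head (vertex_graph v) = snd"
  by (simp_all add: vertex_graph_def)

lemma star_graph_eq: "n \<ge> 1 \<Longrightarrow> with_proj (star_graph n) = star_on {1..<n}"
  unfolding star_graph_def star_on_def
  by (rule arg_cong[of _ _ with_proj]) auto

lemma graph_star_on:
  assumes "finite S" "0 \<notin> S"
  shows "graph (star_on S)"
proof -
  have "finite ({0} \<times> S \<union> S \<times> {0})" using assms by auto
  then show ?thesis
    using assms by unfold_locales (auto simp: arc_to_ends_def symmetric_def sym_def)
qed

lemma graph_vertex_graph: "graph (vertex_graph v)"
  by unfold_locales (auto simp: symmetric_def)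

lemma connected_star_on: "Digraph_Component.connected (star_on S)"
proof -
  interpret wf_digraph "star_on S" by unfold_locales auto
  have "0 \<rightarrow>\<^sup>*\<^bsub>star_on S\<^esub> u" "u \<rightarrow>\<^sup>*\<^bsub>star_on S\<^esub> 0" if "u \<in> verts (star_on S)" for u
    using that reachable_adjI[of 0 u] reachable_adjI[of u 0] reachable_refl[of 0] by auto
  then have "strongly_connected (star_on S)"
    by (intro strongly_connectedI) (auto intro: reachable_trans)
  moreover have "with_proj (mk_symmetric (star_on S)) = star_on S"
    by (auto simp: mk_symmetric_def star_on_def with_proj_def)
  ultimately show ?thesis by (simp add: Digraph_Component.connected_def)
qed

lemma connected_vertex_graph: "Digraph_Component.connected (vertex_graph v)"
  by (auto simp: connected_conv)

lemma pcas_ends_in_verts: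
  assumes "pcas u p v"
  shows "u \<in> set (pawalk_verts u p)" "v \<in> set (pawalk_verts u p)"
  using assms by (induction p arbitrary: u) auto

text \<open>
  A walk in a star is at the centre at every other step. A closed walk of length at least three
  from the centre is back there after two steps, before its end; one from a leaf is at the centre
  after one step and again after three. A cycle repeats no vertex in either way.
\<close>

lemma star_on_no_long_cycle:
  assumes "0 \<notin> S" "pre_digraph.cycle (star_on S) p"
  shows "length p < 3"
proof (rule ccontr)
  assume "\<not> length p < 3"
  then obtain e1 e2 e3 q where p: "p = e1 # e2 # e3 # q"
    by (auto simp: not_less Suc_le_length_iff numeral_3_eq_3)
  obtain u where u: "set p \<subseteq> {0} \<times> S \<union> S \<times> {0}" "pcas u p u" "distinct (tl (pawalk_verts u p))"
    using assms(2) unfolding pre_digraph.cycle_def pre_digraph.awalk_def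
    by (auto simp: star_on_def cas_with_proj_eq awalk_verts_with_proj_eq)
  have "u \<in> set (pawalk_verts (snd e3) q)" "snd e3 \<in> set (pawalk_verts (snd e3) q)"
    using pcas_ends_in_verts[of "snd e3" q u] u(2) by (simp_all add: p)
  then have "fst e3 \<noteq> u" "fst e2 \<noteq> snd e3"
    using u(3) by (auto simp: p)
  then show False using u(1,2) assms(1) by (auto simp: p)
qed

lemma tree_graph_star_on:
  assumes "finite S" "0 \<notin> S"
  shows "tree_graph (star_on S)"
  using assms star_on_no_long_cycle[of S]
  by (auto simp: tree_graph_def graph_star_on connected_star_on not_le)


section \<open>Subtrees of stars\<close>

lemma connected_graph_in_arc:
  assumes "graph H" "Digraph_Component.connected H" "u \<in> verts H" "v \<in> verts H" "u \<noteq> v"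
  obtains w where "(w, v) \<in> arcs_ends H"
proof -
  interpret graph H by fact
  have "u \<rightarrow>\<^sup>*\<^bsub>H\<^esub> v"
    using symmetric_connected_imp_strongly_connected[OF sym_arcs assms(2)] assms(3,4) by auto
  then have "(u, v) \<in> (arcs_ends H)\<^sup>*" by (simp add: reachable_conv)
  then show ?thesis using assms(5) that by (auto elim: rtranclE)
qed

text \<open>
  Each leaf has only the centre as a neighbour. So a connected subgraph avoiding the centre has no
  edge, and one containing the centre has the edge from the centre to each of its leaves.
\<close>

lemma is_subtree_star_on_iff:
  assumes "finite S" "0 \<notin> S"
  shows "is_subtree H (star_on S) \<longleftrightarrow> (\<exists>v\<in>S. H = vertex_graph v) \<or> (\<exists>R\<subseteq>S. H = star_on R)"
proof
  assume "is_subtree H (star_on S)"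
  then have sub: "subgraph H (star_on S)" and gr: "graph H"
    and con: "Digraph_Component.connected H"
    by (auto simp: is_subtree_def)
  interpret graph H by fact
  have vs: "verts H \<subseteq> insert 0 S" and as: "arcs H \<subseteq> {0} \<times> S \<union> S \<times> {0}"
    and th: "tail H = fst" "head H = snd"
    using sub by (auto simp: subgraph_def compatible_def)
  have ends: "arcs_ends H = arcs H" by (auto simp: arcs_ends_conv th)
  have arc_verts: "fst e \<in> verts H \<and> snd e \<in> verts H" if "e \<in> arcs H" for e
    using wellformed[OF that] th by simp
  have swap: "(y, x) \<in> arcs H" if "(x, y) \<in> arcs H" for x y
    using graph_symmetric[of x y] that by (simp add: ends)
  have eqI: "H = K" if "verts H = verts K" "arcs H = arcs K" "tail K = fst" "head K = snd"
    for K :: "(nat, nat \<times> nat) pre_digraph"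
    using that th by (cases H; cases K) simp
  show "(\<exists>v\<in>S. H = vertex_graph v) \<or> (\<exists>R\<subseteq>S. H = star_on R)"
  proof (cases "0 \<in> verts H")
    case True
    define R where "R = verts H - {0}"
    have leaf: "(0, v) \<in> arcs H" if v: "v \<in> R" for v
    proof -
      obtain w where "(w, v) \<in> arcs_ends H"
        using connected_graph_in_arc[OF gr con True, of v] v by (auto simp: R_def)
      then show ?thesis using as v by (auto simp: ends R_def)
    qed
    have "arcs H = {0} \<times> R \<union> R \<times> {0}"
    proof
      show "arcs H \<subseteq> {0} \<times> R \<union> R \<times> {0}"
      proof
        fix e assume "e \<in> arcs H"
        then show "e \<in> {0} \<times> R \<union> R \<times> {0}"
          using subsetD[OF as] arc_verts[of e] assms(2) by (cases e) (auto simp: R_def intro!: gr0I)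
      qed
    qed (use leaf swap in auto)
    then have "H = star_on R" using True by (intro eqI) (auto simp: R_def)
    moreover have "R \<subseteq> S" using vs by (auto simp: R_def)
    ultimately show ?thesis by blast
  next
    case False
    then have no_arcs: "arcs H = {}" using as arc_verts by fastforce
    obtain v where v: "v \<in> verts H" using con by (auto simp: connected_conv)
    have "verts H = {v}"
      using connected_graph_in_arc[OF gr con v] v by (auto simp: ends no_arcs)
    then have "H = vertex_graph v" using no_arcs by (intro eqI) auto
    moreover have "v \<in> S" using v vs False by auto
    ultimately show ?thesis by blast
  qed
next
  assume "(\<exists>v\<in>S. H = vertex_graph v) \<or> (\<exists>R\<subseteq>S. H = star_on R)"
  then show "is_subtree H (star_on S)"
  proof (elim disjE bexE exE conjE)
    fix v assume "v \<in> S" "H = vertex_graph v"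
    then show ?thesis
      using graph_star_on[OF assms] graph_vertex_graph[of v]
      by (auto simp: is_subtree_def subgraph_def compatible_def connected_vertex_graph
          graph_def digraph_def fin_digraph_def)
  next
    fix R assume R: "R \<subseteq> S" "H = star_on R"
    then have "graph (star_on R)"
      using assms by (intro graph_star_on) (auto intro: finite_subset)
    then show ?thesis
      using graph_star_on[OF assms] R
      by (auto simp: is_subtree_def subgraph_def compatible_def connected_star_on
          graph_def digraph_def fin_digraph_def)
  qed
qed

lemma num_subtrees_star_on:
  assumes "finite S" "0 \<notin> S"
  shows "num_subtrees (star_on S) (Suc j) = (if j = 0 then card S else 0) + (card S choose j)"
proof -
  define L where "L = (if j = 0 then vertex_graph ` S else {})"
  define C where "C = star_on ` {R. R \<subseteq> S \<and> card R = j}"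
  have card_centre: "card (verts (star_on R)) = Suc (card R)" if "R \<subseteq> S" for R
    using that assms finite_subset[of R S] by (auto simp: card_insert_if)
  have "{H. is_subtree H (star_on S) \<and> card (verts H) = Suc j} = L \<union> C"
    unfolding is_subtree_star_on_iff[OF assms] L_def C_def using card_centre by auto
  moreover have "inj_on vertex_graph S"
    by (auto intro!: inj_onI dest: arg_cong[of _ _ verts])
  then have "card L = (if j = 0 then card S else 0)" by (simp add: L_def card_image)
  moreover have "inj_on star_on {R. R \<subseteq> S \<and> card R = j}"
  proof (rule inj_onI, goal_cases)
    case (1 R R')
    then have "insert 0 R = insert 0 R'" by (metis star_on_simps(1))
    then show ?case using 1 assms(2) by (metis (no_types, lifting) insert_ident mem_Collect_eq subsetD)
  qed
  then have "card C = (card S choose j)" by (simp add: C_def card_image n_subsets assms)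
  moreover have "L \<inter> C = {}"
  proof -
    have "vertex_graph v \<noteq> star_on R" if "v \<in> S" for v R
      using that assms(2) by (auto dest!: arg_cong[of _ _ verts])
    then show ?thesis by (auto simp: L_def C_def)
  qed
  moreover have "finite L" "finite C" using assms by (auto simp: L_def C_def)
  ultimately show ?thesis by (simp add: num_subtrees_def card_Un_disjoint)
qed

text \<open>
  A set of \<open>j\<close> leaves gives a subtree with \<open>j + 1\<close> vertices, so the subtrees containing the centre
  contribute \<open>z\<close> times a binomial expansion; the term \<open>card S\<close> comes from the single leaves.
\<close>

lemma poly_star:
  assumes "finite S" "0 \<notin> S"
  shows "poly (subtree_poly (star_on S)) z = z * (of_nat (card S) + (1 + z) ^ card S)"
proof -
  let ?m = "card S"
  have "poly (subtree_poly (star_on S)) z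
      = (\<Sum>k = 1..Suc ?m. of_nat (num_subtrees (star_on S) k) * z ^ k)"
    using assms by (simp add: subtree_poly_def poly_sum poly_monom)
  also have "\<dots> = (\<Sum>j = 0..?m. of_nat (num_subtrees (star_on S) (Suc j)) * z ^ Suc j)"
    by (simp only: One_nat_def sum.shift_bounds_cl_Suc_ivl)
  also have "\<dots> = (\<Sum>j\<le>?m. (if j = 0 then of_nat ?m * z else 0) +
      z * (of_nat (?m choose j) * z ^ j))"
    by (intro sum.cong) (auto simp: num_subtrees_star_on[OF assms] atLeast0AtMost algebra_simps)
  also have "\<dots> = of_nat ?m * z + z * (\<Sum>j\<le>?m. of_nat (?m choose j) * z ^ j)"
    by (simp add: sum.distrib sum_distrib_left)
  also have "(\<Sum>j\<le>?m. of_nat (?m choose j) * z ^ j) = (1 + z) ^ ?m"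
    using binomial_ring[of z 1 ?m] by (simp add: add.commute)
  finally show ?thesis by (simp add: algebra_simps)
qed


section \<open>The root and its asymptotics\<close>

lemma xi_eq: "1 + xi n = complex_of_real (a_seq n) * cis (pi / (real n - 1))"
  by (simp add: xi_def complex_eq_iff)

lemma xi_power:
  assumes "n \<ge> 2"
  shows "(1 + xi n) ^ (n - 1) = - of_nat (n - 1)"
proof -
  have m: "real (n - 1) = real n - 1" "real n - 1 > 0" using assms by auto
  have "a_seq n ^ (n - 1) = real n - 1"
    using m by (simp add: a_seq_def powr_realpow[symmetric] powr_powr)
  moreover have "cis (pi / (real n - 1)) ^ (n - 1) = -1"
    using m by (simp add: Complex.DeMoivre)
  ultimately show ?thesis
    unfolding xi_eq power_mult_distrib of_real_power[symmetric] using m by simp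
qed

lemma xi_nonzero:
  assumes "n \<ge> 3"
  shows "xi n \<noteq> 0"
proof -
  have "sin (pi / (real n - 1)) > 0"
    using assms by (intro sin_gt_zero) (auto simp: divide_less_eq)
  moreover have "a_seq n > 0" using assms by (simp add: a_seq_def)
  ultimately have "Im (xi n) > 0" by (simp add: xi_def)
  then show ?thesis by auto
qed

text \<open>
  With \<open>m = n - 1\<close>, \<open>a = a\<^sub>n\<close> and \<open>\<theta> = \<pi> / m\<close>, one has
  \<open>|\<xi>\<^sub>n|\<^sup>2 = (a - 1)\<^sup>2 + 2 a (1 - cos \<theta>)\<close>. Since \<open>a = exp (ln m / m)\<close>, the first summand is of
  order \<open>(ln m / m)\<^sup>2\<close>; the second is of order \<open>1 / m\<^sup>2\<close>, hence negligible.
\<close>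

lemma xi_asymp: "(\<lambda>n. cmod (xi n) / (a_seq n - 1)) \<longlonglongrightarrow> 1"
  unfolding xi_def a_seq_def cmod_def by simp real_asymp

theorem mainTheorem4:
  shows "(\<forall>n\<ge>3. tree_graph (with_proj (star_graph n)) \<and>
                 card (verts (with_proj (star_graph n))) = n \<and>
                 xi n \<noteq> 0 \<and> subtree_root (with_proj (star_graph n)) (xi n))
       \<and> (\<lambda>n. cmod (xi n) / (a_seq n - 1)) \<longlonglongrightarrow> 1"
proof (intro conjI allI impI)
  fix n :: nat assume n: "n \<ge> 3"
  then have star: "with_proj (star_graph n) = star_on {1..<n}" by (intro star_graph_eq) simp
  show "tree_graph (with_proj (star_graph n))"
    unfolding star by (rule tree_graph_star_on) auto
  show "card (verts (with_proj (star_graph n))) = n" by (simp add: star_graph_def)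
  show "xi n \<noteq> 0" using n by (rule xi_nonzero)
  have "poly (subtree_poly (star_on {1..<n})) (xi n) = 0"
    using xi_power[of n] n by (subst poly_star) auto
  then show "subtree_root (with_proj (star_graph n)) (xi n)"
    by (simp add: subtree_root_def star)
qed (rule xi_asymp)

end
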